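(* Let $F$ be an infinite field and let $R$ be a left (respectively, right) Artinian $F$-algebra. Then $R^*$ cannot have a unipotent maximal subgroup; that is, no maximal subgroup of $R^*$ is a unipotent group.
   Context: Algebras are associative and unital. $R^*$ is the unit group of $R$. An element $x\in R$ is unipotent if $1-x$ is nilpotent. A subgroup of $R^*$ is a unipotent group if each of its elements is unipotent. A maximal subgroup is a proper subgroup that is maximal under inclusion among proper subgroups. *)

theory Defs
  imports "HOL-Algebra.Algebra"
begin

text \<open>
  The library locale \<^locale>\<open>algebra\<close> requires the algebra to be commutative. The following
  locale is the noncommutative version: an associative unital ring \<open>M\<close> that is a module
  over the commutative ring \<open>R\<close>, with multiplication bilinear over \<open>R\<close>. As usual for
  unital algebras, the zero ring is allowed, and \<open>M\<close> need not be finitely generated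
  over \<open>R\<close>.
\<close>

locale assoc_algebra = module + ring M +
  assumes smult_mult_left:
      "\<lbrakk>a \<in> carrier R; x \<in> carrier M; y \<in> carrier M\<rbrakk> \<Longrightarrow>
       (a \<odot>\<^bsub>M\<^esub> x) \<otimes>\<^bsub>M\<^esub> y = a \<odot>\<^bsub>M\<^esub> (x \<otimes>\<^bsub>M\<^esub> y)"
    and smult_mult_right:
      "\<lbrakk>a \<in> carrier R; x \<in> carrier M; y \<in> carrier M\<rbrakk> \<Longrightarrow>
       x \<otimes>\<^bsub>M\<^esub> (a \<odot>\<^bsub>M\<^esub> y) = a \<odot>\<^bsub>M\<^esub> (x \<otimes>\<^bsub>M\<^esub> y)"

locale left_ideal = additive_subgroup I R + ring R for I and R (structure) +
  assumes l_closed: "\<lbrakk>a \<in> I; x \<in> carrier R\<rbrakk> \<Longrightarrow> x \<otimes> a \<in> I"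

locale right_ideal = additive_subgroup I R + ring R for I and R (structure) +
  assumes r_closed: "\<lbrakk>a \<in> I; x \<in> carrier R\<rbrakk> \<Longrightarrow> a \<otimes> x \<in> I"

locale left_artinian_ring = ring +
  assumes left_dcc:
    "\<lbrakk>\<And>i. left_ideal (I i) R; \<And>i. I (Suc i) \<subseteq> I i\<rbrakk> \<Longrightarrow> \<exists>n::nat. \<forall>i\<ge>n. I i = I n"

locale right_artinian_ring = ring +
  assumes right_dcc:
    "\<lbrakk>\<And>i. right_ideal (I i) R; \<And>i. I (Suc i) \<subseteq> I i\<rbrakk> \<Longrightarrow> \<exists>n::nat. \<forall>i\<ge>n. I i = I n"

definition nilpotent_elem :: "('a, 'm) ring_scheme \<Rightarrow> 'a \<Rightarrow> bool"
  where "nilpotent_elem R x \<longleftrightarrow> x \<in> carrier R \<and> (\<exists>n::nat. x [^]\<^bsub>R\<^esub> n = \<zero>\<^bsub>R\<^esub>)"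

definition unipotent_elem :: "('a, 'm) ring_scheme \<Rightarrow> 'a \<Rightarrow> bool"
  where "unipotent_elem R x \<longleftrightarrow> x \<in> carrier R \<and> nilpotent_elem R (\<one>\<^bsub>R\<^esub> \<ominus>\<^bsub>R\<^esub> x)"

definition unipotent_group :: "'a set \<Rightarrow> ('a, 'm) ring_scheme \<Rightarrow> bool"
  where "unipotent_group H R \<longleftrightarrow> subgroup H (units_of R) \<and> (\<forall>x\<in>H. unipotent_elem R x)"

definition maximal_subgroup :: "'a set \<Rightarrow> ('a, 'm) monoid_scheme \<Rightarrow> bool"
  where "maximal_subgroup H G \<longleftrightarrow>
    subgroup H G \<and> H \<noteq> carrier G \<and>
    (\<forall>K. subgroup K G \<and> K \<noteq> carrier G \<and> H \<subseteq> K \<longrightarrow> K = H)"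

end

theory Submission
  imports Defs
begin

text \<open>
  The nonzero scalars form a central subgroup \<open>Z\<close> of \<open>R\<^sup>*\<close>, and \<open>Z\<close> is infinite because \<open>F\<close>
  is. The only unipotent scalar is \<open>1\<close>: if \<open>c \<noteq> 1\<close>, then \<open>1 - c\<close> is again a nonzero scalar, hence
  a unit, and a unit of a nonzero ring is not nilpotent
  (\<open>unipotent_scalar_eq_one\<close>). So a unipotent subgroup \<open>M\<close> meets \<open>Z\<close> trivially.

  Suppose that \<open>M\<close> is moreover maximal. For each subgroup \<open>K\<close> of \<open>Z\<close> the product \<open>KM\<close> is a subgroup
  between \<open>M\<close> and \<open>R\<^sup>*\<close>, and \<open>KM \<inter> Z = K\<close> recovers \<open>K\<close>; so maximality leaves room only for
  \<open>K = 1\<close> and \<open>K = Z\<close>. But an infinite group always has a nontrivial proper subgroup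
  (\<open>infinite_group_nontrivial_proper_subgroup\<close>), which is a contradiction
  (\<open>maximal_subgroup_meets_infinite_central_subgroup\<close>). In the zero ring there are no scalars
  other than \<open>1\<close>, but there the unit group is trivial and has no proper subgroups.
\<close>

text \<open>
  If an element \<open>a \<noteq> 1\<close> does not generate the group, it generates such a subgroup. Otherwise the
  group is infinite cyclic, and the powers of the square of \<open>a\<close> miss \<open>a\<close> itself.
\<close>

lemma (in group) infinite_group_nontrivial_proper_subgroup:
  assumes inf: "infinite (carrier G)"
  shows "\<exists>K. subgroup K G \<and> K \<noteq> {\<one>} \<and> K \<noteq> carrier G"
proof -
  from inf have "\<not> carrier G \<subseteq> {\<one>}"
    using finite_subset by blast
  then obtain a where a: "a \<in> carrier G" "a \<noteq> \<one>"
    by blast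
  show ?thesis
  proof (cases "generate G {a} = carrier G")
    case False
    moreover have "a \<in> generate G {a}"
      by (simp add: generate.incl)
    ultimately show ?thesis
      using a generate_is_subgroup[of "{a}"] by blast
  next
    case True
    with a inf have ord: "ord a = 0"
      by (simp add: generate_pow_card)
    let ?b = "a [^] (2::int)"
    have b: "?b \<in> carrier G"
      using a by simp
    have "?b \<noteq> \<one>"
      using int_pow_eq_id[OF a(1), of 2] ord by simp
    moreover have "?b \<in> generate G {?b}"
      by (simp add: generate.incl)
    moreover have "a \<notin> generate G {?b}"
    proof
      assume "a \<in> generate G {?b}"
      then obtain k :: int where "a = ?b [^] k"
        using generate_pow[OF b] by auto
      then have "a [^] (1::int) = a [^] (2 * k)"
        using a by (simp add: int_pow_pow)
      then have "2 * k = 1"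
        using int_pow_eq[OF a(1)] ord by auto
      then show False
        by presburger
    qed
    ultimately show ?thesis
      using a b generate_is_subgroup[of "{?b}"] by blast
  qed
qed

lemma (in group) central_subgroup_normal:
  assumes K: "subgroup K G"
    and central: "\<And>z x. z \<in> K \<Longrightarrow> x \<in> carrier G \<Longrightarrow> x \<otimes> z = z \<otimes> x"
  shows "K \<lhd> G"
  unfolding normal_inv_iff
proof (intro conjI ballI)
  fix x z
  assume "x \<in> carrier G" and "z \<in> K"
  then have "x \<otimes> z \<otimes> inv x = z"
    using central[of z x] subgroup.mem_carrier[OF K] by (simp add: m_assoc)
  then show "x \<otimes> z \<otimes> inv x \<in> K"
    using \<open>z \<in> K\<close> by simp
qed (rule K)

text \<open>
  Choose \<open>K \<subset> Z\<close> nontrivial and proper. If \<open>M \<inter> Z\<close> were trivial, \<open>KM\<close> would be strictly larger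
  than \<open>M\<close>, hence the whole group, and the modular law would give \<open>Z = K (M \<inter> Z) = K\<close>.
\<close>

lemma (in group) maximal_subgroup_meets_infinite_central_subgroup:
  assumes max: "maximal_subgroup M G"
    and Z: "subgroup Z G" "infinite Z"
    and central: "\<And>z x. z \<in> Z \<Longrightarrow> x \<in> carrier G \<Longrightarrow> x \<otimes> z = z \<otimes> x"
  shows "\<exists>z \<in> M \<inter> Z. z \<noteq> \<one>"
proof (rule ccontr)
  assume "\<not> ?thesis"
  then have triv: "z = \<one>" if "z \<in> M" "z \<in> Z" for z
    using that by blast
  have M: "subgroup M G" and M_max: "\<And>L. subgroup L G \<Longrightarrow> M \<subseteq> L \<Longrightarrow> L = carrier G \<or> L = M"
    using max unfolding maximal_subgroup_def by blast+
  obtain K where K': "subgroup K (G\<lparr>carrier := Z\<rparr>)" and K: "K \<noteq> {\<one>}" "K \<noteq> Z"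
    using group.infinite_group_nontrivial_proper_subgroup[OF subgroup_imp_group[OF Z(1)]] Z(2)
    by auto
  have KG: "subgroup K G"
    using incl_subgroup[OF Z(1) K'] .
  have KZ: "K \<subseteq> Z"
    using subgroup.subset[OF K'] by simp
  have "K \<lhd> G"
    using central_subgroup_normal[OF KG] central KZ by blast
  then have KM: "subgroup (K <#> M) G"
    using mult_norm_subgroup M by blast
  have one: "\<one> \<in> K" "\<one> \<in> M"
    using KG M subgroup.one_closed by blast+
  have "M \<subseteq> K <#> M"
  proof
    fix m assume "m \<in> M"
    then have "m = \<one> \<otimes> m"
      using subgroup.mem_carrier[OF M] by simp
    with one \<open>m \<in> M\<close> show "m \<in> K <#> M"
      unfolding set_mult_def by blast
  qed
  moreover have "K <#> M \<noteq> M"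
  proof -
    obtain k where k: "k \<in> K" "k \<noteq> \<one>"
      using K(1) one(1) by blast
    then have "k = k \<otimes> \<one>"
      using subgroup.mem_carrier[OF KG] by simp
    then have "k \<in> K <#> M"
      unfolding set_mult_def using k one by blast
    moreover have "k \<notin> M"
      using triv k KZ by blast
    ultimately show ?thesis
      by blast
  qed
  ultimately have all: "K <#> M = carrier G"
    using M_max[OF KM] by blast
  have "Z \<subseteq> K"
  proof
    fix z assume z: "z \<in> Z"
    then obtain k m where km: "k \<in> K" "m \<in> M" "z = k \<otimes> m"
      using all subgroup.mem_carrier[OF Z(1)] unfolding set_mult_def by blast
    have "m = inv k \<otimes> z"
      using km subgroup.mem_carrier[OF KG] subgroup.mem_carrier[OF M]
      by (simp flip: m_assoc)
    moreover have "inv k \<otimes> z \<in> Z"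
      using km z KZ subgroup.m_closed[OF Z(1)] subgroup.m_inv_closed[OF Z(1)] by blast
    ultimately have "m = \<one>"
      using triv km by blast
    with km show "z \<in> K"
      using subgroup.mem_carrier[OF KG] by simp
  qed
  with KZ K show False
    by blast
qed

lemma (in ring) nilpotent_unit_imp_zero_ring:
  assumes "u \<in> Units R" and "nilpotent_elem R u"
  shows "\<one> = \<zero>"
proof -
  obtain n :: nat where n: "u [^] n = \<zero>"
    using assms(2) unfolding nilpotent_elem_def by blast
  have "u [^] n \<in> Units R"
    using assms(1) by (induction n) auto
  then have "\<zero> \<in> Units R"
    using n by simp
  then show ?thesis
    using Units_r_inv[of \<zero>] l_null[OF Units_inv_closed[of \<zero>]] by metis
qed

context assoc_algebra
begin

lemma scalar_mult_scalar:
  assumes "c \<in> carrier R" and "d \<in> carrier R"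
  shows "(c \<odot>\<^bsub>M\<^esub> \<one>\<^bsub>M\<^esub>) \<otimes>\<^bsub>M\<^esub> (d \<odot>\<^bsub>M\<^esub> \<one>\<^bsub>M\<^esub>) = (c \<otimes> d) \<odot>\<^bsub>M\<^esub> \<one>\<^bsub>M\<^esub>"
  using assms by (simp add: smult_mult_left smult_assoc1)

lemma scalar_central:
  assumes "c \<in> carrier R" and "x \<in> carrier M"
  shows "x \<otimes>\<^bsub>M\<^esub> (c \<odot>\<^bsub>M\<^esub> \<one>\<^bsub>M\<^esub>) = (c \<odot>\<^bsub>M\<^esub> \<one>\<^bsub>M\<^esub>) \<otimes>\<^bsub>M\<^esub> x"
  using assms by (simp add: smult_mult_left smult_mult_right)

lemma scalar_in_Units:
  assumes "c \<in> Units R"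
  shows "c \<odot>\<^bsub>M\<^esub> \<one>\<^bsub>M\<^esub> \<in> Units M"
proof -
  have c: "c \<in> carrier R" "inv c \<in> carrier R"
    using assms by auto
  have "(c \<odot>\<^bsub>M\<^esub> \<one>\<^bsub>M\<^esub>) \<otimes>\<^bsub>M\<^esub> (inv c \<odot>\<^bsub>M\<^esub> \<one>\<^bsub>M\<^esub>) = \<one>\<^bsub>M\<^esub>"
    and "(inv c \<odot>\<^bsub>M\<^esub> \<one>\<^bsub>M\<^esub>) \<otimes>\<^bsub>M\<^esub> (c \<odot>\<^bsub>M\<^esub> \<one>\<^bsub>M\<^esub>) = \<one>\<^bsub>M\<^esub>"
    using assms c by (simp_all add: scalar_mult_scalar)
  then show ?thesis
    using c unfolding Units_def by blast
qed

lemma scalar_units_subgroup: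
  "subgroup ((\<lambda>c. c \<odot>\<^bsub>M\<^esub> \<one>\<^bsub>M\<^esub>) ` Units R) (units_of M)"
proof -
  have "(\<lambda>c. c \<odot>\<^bsub>M\<^esub> \<one>\<^bsub>M\<^esub>) \<in> hom (units_of R) (units_of M)"
    by (auto simp: hom_def units_of_carrier units_of_mult scalar_in_Units scalar_mult_scalar
        R.Units_closed)
  then have "group_hom (units_of R) (units_of M) (\<lambda>c. c \<odot>\<^bsub>M\<^esub> \<one>\<^bsub>M\<^esub>)"
    using R.units_group units_group unfolding group_hom_def group_hom_axioms_def by blast
  then show ?thesis
    using group_hom.img_is_subgroup by (fastforce simp: units_of_carrier)
qed

lemma one_minus_scalar:
  assumes "c \<in> carrier R"
  shows "\<one>\<^bsub>M\<^esub> \<ominus>\<^bsub>M\<^esub> c \<odot>\<^bsub>M\<^esub> \<one>\<^bsub>M\<^esub> = (\<one> \<ominus> c) \<odot>\<^bsub>M\<^esub> \<one>\<^bsub>M\<^esub>"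
  using assms by (simp add: a_minus_def R.minus_eq smult_l_distr smult_l_minus)

text \<open>
  Over a field the scalar \<open>1 - c\<close> is a unit unless \<open>c = 1\<close>, and units are not nilpotent.
\<close>

lemma unipotent_scalar_eq_one:
  assumes "field R" and "\<one>\<^bsub>M\<^esub> \<noteq> \<zero>\<^bsub>M\<^esub>" and c: "c \<in> carrier R"
    and uni: "unipotent_elem M (c \<odot>\<^bsub>M\<^esub> \<one>\<^bsub>M\<^esub>)"
  shows "c = \<one>"
proof (rule ccontr)
  assume "c \<noteq> \<one>"
  then have "\<one> \<ominus> c \<noteq> \<zero>"
    using c by (metis R.one_closed R.r_right_minus_eq)
  then have "\<one> \<ominus> c \<in> Units R"
    using field.field_Units[OF assms(1)] c by simp
  then have "(\<one> \<ominus> c) \<odot>\<^bsub>M\<^esub> \<one>\<^bsub>M\<^esub> \<in> Units M"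
    by (rule scalar_in_Units)
  moreover have "nilpotent_elem M ((\<one> \<ominus> c) \<odot>\<^bsub>M\<^esub> \<one>\<^bsub>M\<^esub>)"
    using uni one_minus_scalar[OF c] unfolding unipotent_elem_def by simp
  ultimately show False
    using nilpotent_unit_imp_zero_ring assms(2) by blast
qed

text \<open>
  If \<open>c\<close> and \<open>d\<close> give the same scalar, \<open>c / d\<close> acts as \<open>1\<close>, which is unipotent.
\<close>

lemma scalar_inj_on_Units:
  assumes "field R" and "\<one>\<^bsub>M\<^esub> \<noteq> \<zero>\<^bsub>M\<^esub>"
  shows "inj_on (\<lambda>c. c \<odot>\<^bsub>M\<^esub> \<one>\<^bsub>M\<^esub>) (Units R)"
proof (rule inj_onI)
  fix c d
  assume c: "c \<in> Units R" and d: "d \<in> Units R"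
    and eq: "c \<odot>\<^bsub>M\<^esub> \<one>\<^bsub>M\<^esub> = d \<odot>\<^bsub>M\<^esub> \<one>\<^bsub>M\<^esub>"
  have cl: "c \<in> carrier R" "d \<in> carrier R" "inv d \<in> carrier R"
    using c d by auto
  have "(c \<otimes> inv d) \<odot>\<^bsub>M\<^esub> \<one>\<^bsub>M\<^esub> = (d \<otimes> inv d) \<odot>\<^bsub>M\<^esub> \<one>\<^bsub>M\<^esub>"
    using eq cl by (simp flip: scalar_mult_scalar)
  then have "(c \<otimes> inv d) \<odot>\<^bsub>M\<^esub> \<one>\<^bsub>M\<^esub> = \<one>\<^bsub>M\<^esub>"
    using d by simp
  moreover have "unipotent_elem M \<one>\<^bsub>M\<^esub>"
    unfolding unipotent_elem_def nilpotent_elem_def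
    by (auto simp: a_minus_def M.r_neg intro: exI[of _ "1::nat"])
  ultimately have "c \<otimes> inv d = \<one>"
    using unipotent_scalar_eq_one[OF assms, of "c \<otimes> inv d"] cl by simp
  then have "c \<otimes> inv d \<otimes> d = d"
    using cl by simp
  then show "c = d"
    using cl d by (simp add: R.m_assoc)
qed

end

theorem corollary5p5:
  fixes F :: "('f, 'k) ring_scheme" and R :: "('f, 'a, 'm) module_scheme"
  assumes "field F" and "infinite (carrier F)"
    and "assoc_algebra F R"
    and "left_artinian_ring R \<or> right_artinian_ring R"
  shows "\<not> (\<exists>M. maximal_subgroup M (units_of R) \<and> unipotent_group M R)"
proof
  assume "\<exists>M. maximal_subgroup M (units_of R) \<and> unipotent_group M R"
  then obtain M where max: "maximal_subgroup M (units_of R)" and uni: "unipotent_group M R"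
    by blast
  interpret assoc_algebra F R
    by fact
  interpret U: group "units_of R"
    by (rule units_group)
  let ?scalar = "\<lambda>c. c \<odot>\<^bsub>R\<^esub> \<one>\<^bsub>R\<^esub>"
  show False
  proof (cases "\<one>\<^bsub>R\<^esub> = \<zero>\<^bsub>R\<^esub>")
    case True
    then have "carrier (units_of R) \<subseteq> {\<one>\<^bsub>R\<^esub>}"
      using one_zeroD by (auto simp: units_of_carrier)
    moreover have "\<one>\<^bsub>R\<^esub> \<in> M"
      using max subgroup.one_closed unfolding maximal_subgroup_def by (force simp: units_of_one)
    ultimately show False
      using max subgroup.subset unfolding maximal_subgroup_def by blast
  next
    case False
    have "infinite (Units F)"
      using assms(2) by (simp add: field.field_Units[OF assms(1)])
    then have "infinite (?scalar ` Units F)"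
      using finite_imageD scalar_inj_on_Units[OF assms(1) False] by blast
    moreover have "x \<otimes>\<^bsub>units_of R\<^esub> z = z \<otimes>\<^bsub>units_of R\<^esub> x"
      if "z \<in> ?scalar ` Units F" "x \<in> carrier (units_of R)" for x z
      using that by (auto simp: units_of_mult units_of_carrier intro!: scalar_central)
    ultimately obtain c
      where c: "c \<in> Units F" "?scalar c \<in> M" "?scalar c \<noteq> \<one>\<^bsub>R\<^esub>"
      using U.maximal_subgroup_meets_infinite_central_subgroup[OF max scalar_units_subgroup]
      by (auto simp: units_of_one)
    then have "c = \<one>\<^bsub>F\<^esub>"
      using unipotent_scalar_eq_one[OF assms(1) False] uni unfolding unipotent_group_def by blast
    with c(3) show False
      by simp
  qed
qed

end
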